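(* Let $m\in\mathbb{N}$ with $m\ge 2$, let $a_1,\ldots,a_m$ be distinct real numbers, and let $F\subset\mathbb{R}$ be a nonempty compact convex set with $0\in\operatorname{int}(F)$. Then the global optimal solution set $S_2^F\subset\mathbb{R}^2$ of the problem $$\min\Big\{f_2^F(x_1,x_2)=\max_{1\le i\le m}\Big(\min_{\ell\in\{1,2\}}\rho_F(x_\ell-a_i)\Big)\ \Big|\ (x_1,x_2)\in\mathbb{R}\times\mathbb{R}\Big\}$$ is compact.
   Context: The Minkowski gauge function $\rho_F:\mathbb{R}\to[0,\infty)$ of $F$ is $\rho_F(x)=\inf\{t\ge 0\mid x\in tF\}$. $S_2^F$ is the set of all global minimizers of $f_2^F$ over $\mathbb{R}^2$. *)

theory Defs
  imports "HOL-Analysis.Analysis"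
begin

text \<open>The infimum is taken in the reals, so it is meaningful only when some nonnegative dilate of
  \<open>F\<close> contains \<open>x\<close>; this holds for every \<open>x\<close> as soon as \<open>0\<close> is an interior point of \<open>F\<close>.\<close>

definition minkowski_gauge :: "real set \<Rightarrow> real \<Rightarrow> real" where
  "minkowski_gauge F x = Inf {t. 0 \<le> t \<and> x \<in> (\<lambda>y. t * y) ` F}"

text \<open>The points \<open>a\<^sub>1, \<dots>, a\<^sub>m\<close> are the values of \<open>a\<close> on \<open>{1..m}\<close>; values of \<open>a\<close> elsewhere are
  irrelevant. The maximum is over a nonempty set when \<open>m \<ge> 1\<close>.\<close>

definition two_center_objective ::
    "real set \<Rightarrow> nat \<Rightarrow> (nat \<Rightarrow> real) \<Rightarrow> real \<times> real \<Rightarrow> real" where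
  "two_center_objective F m a = (\<lambda>(x1, x2).
     MAX i\<in>{1..m}. min (minkowski_gauge F (x1 - a i)) (minkowski_gauge F (x2 - a i)))"

definition two_center_solutions ::
    "real set \<Rightarrow> nat \<Rightarrow> (nat \<Rightarrow> real) \<Rightarrow> (real \<times> real) set" where
  "two_center_solutions F m a =
     {x. \<forall>y. two_center_objective F m a x \<le> two_center_objective F m a y}"

end

(* A compact convex F with 0 in its interior is an interval [-p, q], whose gauge is max (y/q) (-y/p).
   If D is the diameter of the data, one centre has covering radius at least R = D/(p+q), whereas two
   centres do strictly better: use one of them for the largest point alone. Hence at a minimizer each
   centre lies within gauge R of some data point, which bounds the solution set; it is
   closed because it is an intersection of sublevel sets of continuous functions. *)
theory Submission
  imports Defs
begin

text \<open>For \<open>t > 0\<close> the dilate is \<open>{- t * p..t * q}\<close>, so membership of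
  \<open>y\<close> is two lower bounds on \<open>t\<close>. The admissible \<open>t\<close> thus
  form a closed ray, whose infimum is its endpoint.\<close>

lemma minkowski_gauge_atLeastAtMost:
  assumes p: "0 < p" and q: "0 < q"
  shows "minkowski_gauge {-p..q} y = max (y / q) (- y / p)"
proof -
  have "(0 \<le> t \<and> y \<in> (\<lambda>y. t * y) ` {-p..q}) \<longleftrightarrow> max (y / q) (- y / p) \<le> t" for t
  proof (cases "t > 0")
    case True
    then have "y \<in> (\<lambda>y. t * y) ` {-p..q} \<longleftrightarrow> - (t * p) \<le> y \<and> y \<le> t * q"
      by simp
    also have "\<dots> \<longleftrightarrow> max (y / q) (- y / p) \<le> t"
      unfolding max.bounded_iff pos_divide_le_eq[OF p] pos_divide_le_eq[OF q] by auto
    finally show ?thesis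
      using True by simp
  next
    case False
    \<comment> \<open>The maximum is positive unless \<open>y = 0\<close>. This settles
      \<open>t = 0\<close>, where the dilate is \<open>{0}\<close>, and \<open>t < 0\<close>, where
      both sides fail.\<close>
    have "y / q > 0 \<or> - y / p > 0 \<or> y = 0"
      using p q by (cases y "0::real" rule: linorder_cases) (simp_all add: divide_neg_pos)
    moreover have "0 \<in> (\<lambda>y. 0 * y) ` {-p..q}"
      using p q by (auto simp: image_iff intro!: bexI[of _ 0])
    ultimately show ?thesis
      using False by (cases "t = 0") auto
  qed
  then have "{t. 0 \<le> t \<and> y \<in> (\<lambda>y. t * y) ` {-p..q}} = {max (y / q) (- y / p)..}"
    unfolding atLeast_def by presburger
  then show ?thesis
    unfolding minkowski_gauge_def by (simp only: cInf_atLeast)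
qed

lemma two_center_objective_le_iff:
  assumes "1 \<le> m"
  shows "two_center_objective F m a (u, v) \<le> c \<longleftrightarrow>
    (\<forall>i\<in>{1..m}. min (minkowski_gauge F (u - a i)) (minkowski_gauge F (v - a i)) \<le> c)"
  using assms unfolding two_center_objective_def by (subst prod.case, subst Max_le_iff) auto

lemma two_center_objective_less_iff:
  assumes "1 \<le> m"
  shows "two_center_objective F m a (u, v) < c \<longleftrightarrow>
    (\<forall>i\<in>{1..m}. min (minkowski_gauge F (u - a i)) (minkowski_gauge F (v - a i)) < c)"
  using assms unfolding two_center_objective_def by (subst prod.case, subst Max_less_iff) auto

text \<open>Comparing with a fixed \<open>y\<close> amounts to one condition per data point, each
  closed in \<open>x\<close>, so continuity of the maximum over \<open>i\<close> is never
  invoked.\<close>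

lemma closed_two_center_solutions:
  assumes "1 \<le> m" and "continuous_on UNIV (minkowski_gauge F)"
  shows "closed (two_center_solutions F m a)"
proof -
  have cont: "continuous_on UNIV (\<lambda>x. minkowski_gauge F (g x - a i))"
    if "continuous_on UNIV g" for i and g :: "real \<times> real \<Rightarrow> real"
    by (rule continuous_on_compose2[OF assms(2)]) (auto intro!: continuous_intros that)
  have "two_center_solutions F m a = (\<Inter>y. \<Inter>i\<in>{1..m}.
      {x. min (minkowski_gauge F (fst x - a i)) (minkowski_gauge F (snd x - a i))
        \<le> two_center_objective F m a y})"
    unfolding two_center_solutions_def using two_center_objective_le_iff[OF assms(1)]
    by (auto simp del: min_le_iff_disj)
  then show ?thesis
    by (auto simp del: min_le_iff_disj
        intro!: closed_INT closed_Collect_le continuous_intros cont)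
qed

theorem theorem2p8:
  fixes m :: nat and a :: "nat \<Rightarrow> real" and F :: "real set"
  assumes "m \<ge> 2"
    and "inj_on a {1..m}"
    and "F \<noteq> {}" and "compact F" and "convex F" and "0 \<in> interior F"
  shows "compact (two_center_solutions F m a)"
proof -
  have "connected F \<and> compact F"
    using assms by (simp add: convex_connected)
  then obtain b q where bq: "F = {b..q}"
    unfolding connected_compact_interval_1 by blast
  define p where "p = - b"
  have F: "F = {-p..q}" by (simp add: bq p_def)
  have p: "p > 0" and q: "q > 0"
    using assms(6) by (simp_all add: F interior_atLeastAtMost_real)
  have gauge: "minkowski_gauge F y = max (y / q) (- y / p)" for y
    by (simp only: F minkowski_gauge_atLeastAtMost[OF p q])
  have gauge_less: "minkowski_gauge F y < r \<longleftrightarrow> - r * p < y \<and> y < r * q" for y r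
    using p q by (auto simp: gauge field_simps)
  have m: "1 \<le> m" using assms(1) by simp

  have A: "finite (a ` {1..m})" "a ` {1..m} \<noteq> {}" using m by auto
  obtain j where j: "j \<in> {1..m}" "a j = Max (a ` {1..m})" using Max_in[OF A] by auto
  obtain k where k: "k \<in> {1..m}" "a k = Min (a ` {1..m})" using Min_in[OF A] by auto
  have le_j: "a i \<le> a j" and ge_k: "a k \<le> a i" if "i \<in> {1..m}" for i
    using that A j k by auto
  define B where "B = a ` ({1..m} - {j})"
  \<comment> \<open>Since \<open>m \<ge> 2\<close>, some data point remains after removing the
    largest.\<close>
  have "card ({1..m} - {j}) \<noteq> 0" using j assms(1) by simp
  then have B: "finite B" "B \<noteq> {}" by (auto simp: B_def)
  define s where "s = Max B"
  have "s \<in> B" using Max_in[OF B] by (simp add: s_def)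
  then obtain i where i: "i \<in> {1..m}" "i \<noteq> j" "s = a i" unfolding B_def by blast
  \<comment> \<open>Distinctness of the data enters here: it makes the second largest point
    \<open>s\<close> strictly smaller than \<open>a j\<close>.\<close>
  have "a i \<noteq> a j" using i(1,2) j(1) inj_onD[OF assms(2)] by blast
  with i le_j have sj: "s < a j" by force
  have le_s: "a i' \<le> s" if "i' \<in> {1..m}" "i' \<noteq> j" for i'
    using that B(1) by (auto simp: s_def B_def)
  \<comment> \<open>A centre \<open>u\<close> within gauge less than \<open>R\<close> of both
    extreme points would satisfy \<open>a j - R * p < u < a k + R * q\<close>; this \<open>R\<close>
    makes the two ends equal.\<close>
  define R where "R = (a j - a k) / (p + q)"
  have R: "R * p + R * q = a j - a k"
    unfolding distrib_left[symmetric] using p q by (simp add: R_def)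
  have "a k < a j" using sj i ge_k[OF i(1)] by simp
  then have R0: "R > 0" using p q by (simp add: R_def)

  \<comment> \<open>The midpoint of the interval from \<open>s - R * p\<close> to
    \<open>a k + R * q\<close>, which has positive length \<open>a j - s\<close>. Any point inside
    it is within gauge less than \<open>R\<close> of all data except \<open>a j\<close>, which gets
    its own centre.\<close>
  define z where "z = (s - R * p + a k + R * q) / 2"
  have "two_center_objective F m a (z, a j) < R"
    unfolding two_center_objective_less_iff[OF m]
  proof
    fix i' assume i': "i' \<in> {1..m}"
    show "min (minkowski_gauge F (z - a i')) (minkowski_gauge F (a j - a i')) < R"
    proof (cases "i' = j")
      case True
      then show ?thesis using R0 by (simp add: gauge min_less_iff_disj)
    next
      case False
      have "z > s - R * p" "z < a k + R * q" using R sj by (simp_all add: z_def)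
      then have "minkowski_gauge F (z - a i') < R"
        using le_s[OF i' False] ge_k[OF i'] by (simp add: gauge_less)
      then show ?thesis by simp
    qed
  qed
  then have sol: "two_center_objective F m a (u, v) < R"
    if "(u, v) \<in> two_center_solutions F m a" for u v
    using that by (force simp: two_center_solutions_def intro: le_less_trans)
  have no_single: "\<not> (\<forall>i\<in>{1..m}. minkowski_gauge F (u - a i) < R)" for u
  proof
    assume "\<forall>i\<in>{1..m}. minkowski_gauge F (u - a i) < R"
    from bspec[OF this j(1)] bspec[OF this k(1)] R show False
      unfolding gauge_less by linarith
  qed
  \<comment> \<open>If \<open>u\<close> served no data point, \<open>v\<close> alone would cover all
    of them with gauge below \<open>R\<close>, contradicting \<open>no_single\<close>. The
    hypothesis is symmetric in \<open>u\<close> and \<open>v\<close>, so this bounds both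
    coordinates.\<close>
  have near: "u \<in> {a k - R * p..a j + R * q}"
    if uv: "\<forall>i\<in>{1..m}. minkowski_gauge F (u - a i) < R \<or> minkowski_gauge F (v - a i) < R" for u v
  proof -
    obtain i where i: "i \<in> {1..m}" "minkowski_gauge F (u - a i) < R"
      using no_single[of v] uv by blast
    from i(2) show ?thesis
      using le_j[OF i(1)] ge_k[OF i(1)] unfolding gauge_less atLeastAtMost_iff by linarith
  qed
  have "two_center_solutions F m a
      \<subseteq> {a k - R * p..a j + R * q} \<times> {a k - R * p..a j + R * q}"
  proof (rule subrelI)
    fix u v assume "(u, v) \<in> two_center_solutions F m a"
    from sol[OF this] have "\<forall>i\<in>{1..m}. minkowski_gauge F (u - a i) < R \<or> minkowski_gauge F (v - a i) < R"
      by (simp add: two_center_objective_less_iff[OF m] min_less_iff_disj)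
    then show "(u, v) \<in> {a k - R * p..a j + R * q} \<times> {a k - R * p..a j + R * q}"
      using near[of u v] near[of v u] by (metis SigmaI)
  qed
  then have "bounded (two_center_solutions F m a)"
    by (rule bounded_subset[OF bounded_Times[OF bounded_closed_interval bounded_closed_interval]])
  moreover have "continuous_on UNIV (minkowski_gauge F)"
    unfolding gauge[abs_def] using p q by (intro continuous_intros) auto
  ultimately show ?thesis
    using closed_two_center_solutions[OF m] compact_eq_bounded_closed by blast
qed

end
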